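(* Let $R$ be a ring with unity which is a fully almost prime right ring and which is not local. Then, for any two maximal right ideals $M_1$ and $M_2$ of $R$, either $M_1M_2$ or $M_2M_1$ is idempotent.
   Context: Rings are associative and not necessarily commutative. For right ideals $A,B$, $AB$ is the additive subgroup generated by all products $ab$ with $a\in A$, $b\in B$, and $P^2=PP$. A proper right ideal $P$ of $R$ is an almost prime right ideal if for all right ideals $A,B$ of $R$, $AB\subseteq P$ and $AB\not\subseteq P^2$ imply $A\subseteq P$ or $B\subseteq P$. $R$ is a fully almost prime right ring if every proper right ideal of $R$ is an almost prime right ideal. A right ideal $I$ is idempotent if $I^2=I$. A ring with unity is local if it has a unique maximal right ideal. *)

theory Defs
  imports "HOL-Algebra.Algebra"
begin

locale right_ideal = additive_subgroup I R + ring R for I and R (structure) +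
  assumes I_r_closed: "\<lbrakk>a \<in> I; x \<in> carrier R\<rbrakk> \<Longrightarrow> a \<otimes> x \<in> I"

(* The library's ideal_prod closes the products under sums only; here the additive
   subgroup generated by all products a b is taken literally. *)
definition right_ideal_prod :: "('a, 'b) ring_scheme \<Rightarrow> 'a set \<Rightarrow> 'a set \<Rightarrow> 'a set"
  where "right_ideal_prod R A B = generate (add_monoid R) (A <#>\<^bsub>R\<^esub> B)"

locale maximal_right_ideal = right_ideal +
  assumes I_notcarr: "carrier R \<noteq> I"
    and I_maximal: "\<lbrakk>right_ideal J R; I \<subseteq> J; J \<subseteq> carrier R\<rbrakk> \<Longrightarrow> J = I \<or> J = carrier R"

locale almost_prime_right_ideal = right_ideal +
  assumes I_notcarr: "carrier R \<noteq> I"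
    and I_almost_prime:
      "\<lbrakk>right_ideal A R; right_ideal B R; right_ideal_prod R A B \<subseteq> I;
        \<not> right_ideal_prod R A B \<subseteq> right_ideal_prod R I I\<rbrakk> \<Longrightarrow> A \<subseteq> I \<or> B \<subseteq> I"

locale fully_almost_prime_right_ring = ring +
  assumes all_almost_prime:
    "\<lbrakk>right_ideal P R; P \<noteq> carrier R\<rbrakk> \<Longrightarrow> almost_prime_right_ideal P R"

definition idempotent_right_ideal :: "'a set \<Rightarrow> ('a, 'b) ring_scheme \<Rightarrow> bool"
  where "idempotent_right_ideal I R \<longleftrightarrow> right_ideal I R \<and> right_ideal_prod R I I = I"

definition local_ring :: "('a, 'b) ring_scheme \<Rightarrow> bool"
  where "local_ring R \<longleftrightarrow> ring R \<and> (\<exists>!M. maximal_right_ideal M R)"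

end

theory Submission
  imports Defs
begin

text \<open>
  If \<open>AB\<close> is proper, taking \<open>P = AB\<close> in the almost prime condition leaves only three possibilities:
  \<open>AB\<close> is idempotent, \<open>A \<subseteq> AB\<close>, or \<open>B \<subseteq> AB\<close>. For maximal right ideals \<open>M\<^sub>1\<close>, \<open>M\<^sub>2\<close> the product \<open>M\<^sub>1M\<^sub>2\<close> lies in \<open>M\<^sub>1\<close>, so
  by maximality either remaining alternative gives \<open>M\<^sub>1M\<^sub>2 = M\<^sub>1\<close>. Hence, if neither
  product were idempotent, both \<open>M\<^sub>1M\<^sub>2 = M\<^sub>1\<close> and \<open>M\<^sub>2M\<^sub>1 = M\<^sub>2\<close> would hold, and then
  \<open>M\<^sub>1 = M\<^sub>1M\<^sub>2 = M\<^sub>1(M\<^sub>2M\<^sub>1) = (M\<^sub>1M\<^sub>2)M\<^sub>1 = M\<^sub>1M\<^sub>1\<close>,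
  so \<open>M\<^sub>1M\<^sub>2 = M\<^sub>1\<close> would be idempotent after all.
\<close>

context ring
begin

text \<open>
  Statements about all elements of a product \<open>BC\<close> that are additive in the element, such as closure
  under multiplication, reduce to the generators \<open>b \<otimes> c\<close> because the elements satisfying them
  form an additive subgroup. This lemma and the next one replace induction over generated subgroups.
\<close>

lemma additive_subgroup_preimage:
  assumes "additive_subgroup J R" and f: "f \<in> hom (add_monoid R) (add_monoid R)"
  shows "additive_subgroup {x \<in> carrier R. f x \<in> J} R"
proof -
  interpret J: additive_subgroup J R by fact
  interpret f: group_hom "add_monoid R" "add_monoid R" f
    using f by (simp add: group_hom_def group_hom_axioms_def add.is_group)
  show ?thesis
  proof (rule additive_subgroup.intro, rule add.subgroupI)
    show "{x \<in> carrier R. f x \<in> J} \<noteq> {}"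
      using f.hom_one J.zero_closed by auto
  next
    fix x assume "x \<in> {x \<in> carrier R. f x \<in> J}"
    then show "\<ominus> x \<in> {x \<in> carrier R. f x \<in> J}"
      using f.hom_inv[of x] J.a_inv_closed by (simp add: a_inv_def)
  next
    fix x y assume "x \<in> {x \<in> carrier R. f x \<in> J}" "y \<in> {x \<in> carrier R. f x \<in> J}"
    then show "x \<oplus> y \<in> {x \<in> carrier R. f x \<in> J}"
      using f.hom_mult[of x y] J.a_closed by simp
  qed auto
qed

lemma right_ideal_prod_subset:
  assumes "additive_subgroup J R" and "\<And>a b. \<lbrakk>a \<in> A; b \<in> B\<rbrakk> \<Longrightarrow> a \<otimes> b \<in> J"
  shows "right_ideal_prod R A B \<subseteq> J"
  unfolding right_ideal_prod_def
  using assms by (intro add.generate_subgroup_incl)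
    (auto simp: set_mult_def additive_subgroup_def)

lemma mult_in_right_ideal_prod:
  "\<lbrakk>a \<in> A; b \<in> B\<rbrakk> \<Longrightarrow> a \<otimes> b \<in> right_ideal_prod R A B"
  unfolding right_ideal_prod_def by (rule generate.incl) (auto simp: set_mult_def)

lemma additive_subgroup_right_ideal_prod:
  assumes "A \<subseteq> carrier R" "B \<subseteq> carrier R"
  shows "additive_subgroup (right_ideal_prod R A B) R"
  unfolding right_ideal_prod_def
  using assms by (intro additive_subgroup.intro add.generate_is_subgroup)
    (auto simp: set_mult_def)

lemma right_ideal_right_ideal_prod:
  assumes A: "A \<subseteq> carrier R" and "right_ideal B R"
  shows "right_ideal (right_ideal_prod R A B) R"
proof -
  interpret B: right_ideal B R by fact
  let ?P = "right_ideal_prod R A B"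
  have P: "additive_subgroup ?P R"
    using A B.a_subset by (rule additive_subgroup_right_ideal_prod)
  have "a \<otimes> r \<in> ?P" if a: "a \<in> ?P" and r: "r \<in> carrier R" for a r
  proof -
    have "additive_subgroup {x \<in> carrier R. x \<otimes> r \<in> ?P} R"
      using r by (intro additive_subgroup_preimage P) (auto simp: hom_def l_distr)
    moreover have "b \<otimes> c \<in> {x \<in> carrier R. x \<otimes> r \<in> ?P}" if "b \<in> A" "c \<in> B" for b c
    proof -
      have "b \<otimes> c \<otimes> r = b \<otimes> (c \<otimes> r)"
        using A r B.a_subset that by (auto simp: m_assoc)
      then show ?thesis
        using A r B.a_subset that by (auto intro!: mult_in_right_ideal_prod B.I_r_closed)
    qed
    ultimately have "?P \<subseteq> {x \<in> carrier R. x \<otimes> r \<in> ?P}"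
      by (rule right_ideal_prod_subset)
    with a show ?thesis by blast
  qed
  with P show ?thesis
    by (intro right_ideal.intro right_ideal_axioms.intro ring_axioms)
qed

lemma right_ideal_prod_subset_left:
  assumes "right_ideal A R" "B \<subseteq> carrier R"
  shows "right_ideal_prod R A B \<subseteq> A"
proof -
  interpret A: right_ideal A R by fact
  show ?thesis
    using assms(2) A.I_r_closed
    by (intro right_ideal_prod_subset A.additive_subgroup_axioms) auto
qed

lemma right_ideal_prod_assoc_subset:
  assumes "A \<subseteq> carrier R" "B \<subseteq> carrier R" "C \<subseteq> carrier R"
  shows "right_ideal_prod R A (right_ideal_prod R B C)
    \<subseteq> right_ideal_prod R (right_ideal_prod R A B) C" (is "_ \<subseteq> ?P")
proof -
  have "right_ideal_prod R A B \<subseteq> carrier R"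
    using assms(1,2) by (rule additive_subgroup.a_subset[OF additive_subgroup_right_ideal_prod])
  then have P: "additive_subgroup ?P R"
    using assms by (intro additive_subgroup_right_ideal_prod)
  have "a \<otimes> x \<in> ?P" if a: "a \<in> A" and x: "x \<in> right_ideal_prod R B C" for a x
  proof -
    have "additive_subgroup {x \<in> carrier R. a \<otimes> x \<in> ?P} R"
      using a assms by (intro additive_subgroup_preimage P) (auto simp: hom_def r_distr)
    moreover have "b \<otimes> c \<in> {x \<in> carrier R. a \<otimes> x \<in> ?P}" if "b \<in> B" "c \<in> C" for b c
    proof -
      have "a \<otimes> (b \<otimes> c) = (a \<otimes> b) \<otimes> c"
        using a that assms by (auto simp: m_assoc subset_iff)
      then show ?thesis
        using a that assms by (auto intro!: mult_in_right_ideal_prod)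
    qed
    ultimately have "right_ideal_prod R B C \<subseteq> {x \<in> carrier R. a \<otimes> x \<in> ?P}"
      by (rule right_ideal_prod_subset)
    with x show ?thesis by blast
  qed
  with P show ?thesis by (rule right_ideal_prod_subset)
qed

end

text \<open>
  The almost prime condition is applied to \<open>P = AB\<close> itself: there \<open>AB \<subseteq> P\<close> is trivial, and
  \<open>AB \<subseteq> P\<^sup>2\<close> says that \<open>P\<close> is idempotent.
\<close>

lemma (in fully_almost_prime_right_ring) right_ideal_prod_idempotent_or_absorbs:
  assumes A: "right_ideal A R" and B: "right_ideal B R"
    and proper: "right_ideal_prod R A B \<noteq> carrier R"
  shows "idempotent_right_ideal (right_ideal_prod R A B) R
    \<or> A \<subseteq> right_ideal_prod R A B \<or> B \<subseteq> right_ideal_prod R A B"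
proof -
  let ?P = "right_ideal_prod R A B"
  have "A \<subseteq> carrier R"
    using A by (intro additive_subgroup.a_subset right_ideal.axioms)
  then have P: "right_ideal ?P R"
    using B by (rule right_ideal_right_ideal_prod)
  interpret P: almost_prime_right_ideal ?P R
    using P proper by (rule all_almost_prime)
  have "right_ideal_prod R ?P ?P \<subseteq> ?P"
    using P P.a_subset by (rule right_ideal_prod_subset_left)
  with P show ?thesis
    unfolding idempotent_right_ideal_def using P.I_almost_prime[OF A B] by blast
qed

text \<open>
  The product lies in the proper right ideal \<open>M\<close>. If \<open>N \<subseteq> MN\<close>, then \<open>N \<subseteq> M\<close>, so maximality of \<open>N\<close>
  gives \<open>N = M\<close>; thus this alternative also yields \<open>MN = M\<close>.
\<close>

lemma (in fully_almost_prime_right_ring) maximal_prod_idempotent_or_eq_left: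
  assumes M: "maximal_right_ideal M R" and N: "maximal_right_ideal N R"
  shows "idempotent_right_ideal (right_ideal_prod R M N) R \<or> right_ideal_prod R M N = M"
proof -
  interpret M: maximal_right_ideal M R by fact
  interpret N: maximal_right_ideal N R by fact
  let ?P = "right_ideal_prod R M N"
  have PM: "?P \<subseteq> M"
    using M.right_ideal_axioms N.a_subset by (rule right_ideal_prod_subset_left)
  then have "?P \<noteq> carrier R"
    using M.I_notcarr M.a_subset by blast
  then consider "idempotent_right_ideal ?P R" | "M \<subseteq> ?P" | "N \<subseteq> ?P"
    using right_ideal_prod_idempotent_or_absorbs M.right_ideal_axioms N.right_ideal_axioms
    by blast
  then show ?thesis
  proof cases
    case 3
    then have "N \<subseteq> M" using PM by blast
    then have "M = N"
      using N.I_maximal[OF M.right_ideal_axioms] M.I_notcarr M.a_subset by blast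
    with 3 PM show ?thesis by blast
  qed (use PM in auto)
qed

theorem theorem2p12:
  fixes R :: "('a, 'b) ring_scheme" and M1 M2 :: "'a set"
  assumes "ring R"
    and "fully_almost_prime_right_ring R"
    and "\<not> local_ring R"
    and "maximal_right_ideal M1 R"
    and "maximal_right_ideal M2 R"
  shows "idempotent_right_ideal (right_ideal_prod R M1 M2) R
    \<or> idempotent_right_ideal (right_ideal_prod R M2 M1) R"
proof (rule ccontr)
  assume none: "\<not> ?thesis"
  interpret fully_almost_prime_right_ring R by fact
  interpret M1: maximal_right_ideal M1 R by fact
  interpret M2: maximal_right_ideal M2 R by fact
  have 12: "right_ideal_prod R M1 M2 = M1" and 21: "right_ideal_prod R M2 M1 = M2"
    using none maximal_prod_idempotent_or_eq_left assms(4,5) by blast+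
  have "M1 \<subseteq> right_ideal_prod R M1 M1"
    using right_ideal_prod_assoc_subset[OF M1.a_subset M2.a_subset M1.a_subset]
    by (simp add: 12 21)
  moreover have "right_ideal_prod R M1 M1 \<subseteq> M1"
    using M1.right_ideal_axioms M1.a_subset by (rule right_ideal_prod_subset_left)
  ultimately have "idempotent_right_ideal M1 R"
    using M1.right_ideal_axioms by (simp add: idempotent_right_ideal_def)
  with none 12 show False by simp
qed

end
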